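(* Let $d \in \mathbb{N}$ and let $\boldsymbol{X} = (X_1, \ldots, X_d)$ be a $d$-variate centered Gaussian random vector. Assume that there exist a $d \times d$ signature matrix $D$ and a $d \times d$ matrix $C$ with entries in $[0, \infty)$ such that the random vector $D \boldsymbol{X}$ has the same distribution as the random vector $C \boldsymbol{Z}$, where $\boldsymbol{Z} \sim \mathcal{N}_d(\boldsymbol{0}_d, \boldsymbol{I}_d)$ is a $d$-dimensional standard Gaussian random vector. Then, for all integers $n_1, \dots, n_d \in \mathbb{N}_0$, $$ \mathrm{E} \left( \prod_{i=1}^d X_i^{2 n_i} \right) \geq \prod_{i=1}^d \mathrm{E} \left( X_i^{2 n_i} \right). $$
   Context: $\mathbb{N} = \{1, 2, \ldots\}$ and $\mathbb{N}_0 = \{0, 1, 2, \ldots\}$. A signature matrix is a diagonal matrix whose diagonal elements are all $\pm 1$. Random vectors are viewed as $d \times 1$ column vectors when multiplied by matrices. "Centered" means having zero mean vector. $\mathcal{N}_d(\boldsymbol{0}_d, \boldsymbol{I}_d)$ denotes the $d$-variate Gaussian distribution with zero mean vector $\boldsymbol{0}_d$ and $d \times d$ identity covariance matrix $\boldsymbol{I}_d$. $\mathrm{E}$ denotes expectation. *)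

theory Defs
  imports "HOL-Probability.Probability"
begin

text \<open>
  The standard deviation \<open>\<sigma> = 0\<close> is allowed and gives the point mass at the mean;
  the library's \<open>normal_density\<close> is a probability density for \<open>\<sigma> > 0\<close> only.
\<close>

definition normal_law :: "real \<Rightarrow> real \<Rightarrow> real measure" where
  "normal_law \<mu> \<sigma> =
     (if \<sigma> = 0 then return borel \<mu>
      else density lborel (\<lambda>x. ennreal (normal_density \<mu> \<sigma> x)))"

text \<open>
  A random vector is Gaussian if all its linear combinations are univariate normal, possibly
  degenerate. Singular covariance matrices are thus included.
\<close>

definition gaussian_vector :: "'a measure \<Rightarrow> ('a \<Rightarrow> real ^ 'd) \<Rightarrow> bool" where
  "gaussian_vector M X \<longleftrightarrow>
     prob_space M \<and> X \<in> borel_measurable M \<and>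
     (\<forall>a. \<exists>\<mu> \<sigma>. 0 \<le> \<sigma> \<and> distr M borel (\<lambda>\<omega>. a \<bullet> X \<omega>) = normal_law \<mu> \<sigma>)"

definition mean_vector :: "'a measure \<Rightarrow> ('a \<Rightarrow> real ^ 'd) \<Rightarrow> real ^ 'd" where
  "mean_vector M X = (\<chi> i. \<integral>\<omega>. X \<omega> $ i \<partial>M)"

definition covariance_matrix :: "'a measure \<Rightarrow> ('a \<Rightarrow> real ^ 'd) \<Rightarrow> real ^ 'd ^ 'd" where
  "covariance_matrix M X =
     (\<chi> i j. \<integral>\<omega>. (X \<omega> $ i - mean_vector M X $ i) * (X \<omega> $ j - mean_vector M X $ j) \<partial>M)"

definition centered_gaussian_vector :: "'a measure \<Rightarrow> ('a \<Rightarrow> real ^ 'd) \<Rightarrow> bool" where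
  "centered_gaussian_vector M X \<longleftrightarrow> gaussian_vector M X \<and> mean_vector M X = 0"

definition standard_gaussian_vector :: "'a measure \<Rightarrow> ('a \<Rightarrow> real ^ 'd) \<Rightarrow> bool" where
  "standard_gaussian_vector M Z \<longleftrightarrow>
     gaussian_vector M Z \<and> mean_vector M Z = 0 \<and> covariance_matrix M Z = mat 1"

definition signature_matrix :: "real ^ 'd ^ 'd \<Rightarrow> bool" where
  "signature_matrix D \<longleftrightarrow>
     (\<forall>i j. i \<noteq> j \<longrightarrow> D $ i $ j = 0) \<and> (\<forall>i. D $ i $ i = 1 \<or> D $ i $ i = - 1)"

end

(*
For a centered Gaussian vector X with covariance matrix S, the moments of the normal variable t . X
give E (t . X)^(2m) = (2m)! / (2^m m!) * (t . S t)^m for all t. Both sides are polynomials in t.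
Taking m = n_1 + ... + n_d and comparing the coefficients of t^(2n) expresses E (prod_i X_i^(2 n_i))
as a sum of products of entries of S with positive weights. After the sign change, the entries are
those of C C^T and hence nonnegative, so the sum is at least its purely diagonal term, which is
the product of the moments E X_i^(2 n_i).
*)
theory Submission
  imports Defs
begin

section \<open>Multi-indices and the multinomial expansion\<close>

text \<open>Extensionality (\<open>\<rightarrow>\<^sub>E\<close>) fixes the values outside
  \<open>S\<close>, so that each multi-index is represented by exactly one function and the set is
  finite. For \<open>S = UNIV\<close> it imposes no restriction.\<close>

definition multi_indices :: "'i set \<Rightarrow> nat \<Rightarrow> ('i \<Rightarrow> nat) set" where
  "multi_indices S p = {k \<in> S \<rightarrow>\<^sub>E UNIV. sum k S = p}"

lemma finite_multi_indices: "finite S \<Longrightarrow> finite (multi_indices S p)"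
proof (rule finite_subset)
  assume S: "finite S"
  show "multi_indices S p \<subseteq> S \<rightarrow>\<^sub>E {..p}"
  proof
    fix k assume "k \<in> multi_indices S p"
    then show "k \<in> S \<rightarrow>\<^sub>E {..p}"
      using member_le_sum[of _ S k] S by (force simp: multi_indices_def PiE_def Pi_def)
  qed
  show "finite (S \<rightarrow>\<^sub>E {..p})" using S by (intro finite_PiE) auto
qed

text \<open>Induction on \<open>S\<close>: the binomial theorem splits off the exponent of the new
  index. Weights \<open>1 / fact (k i)\<close> inside the product, in place of multinomial
  coefficients, let each term factor over the indices.\<close>

lemma multinomial_theorem:
  fixes x :: "'i \<Rightarrow> 'a::field_char_0"
  assumes "finite S"
  shows "sum x S ^ p = fact p * (\<Sum>k\<in>multi_indices S p. \<Prod>i\<in>S. x i ^ k i / fact (k i))"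
  using assms
proof (induction S arbitrary: p rule: finite_induct)
  case empty
  show ?case
    by (cases p) (auto simp: multi_indices_def)
next
  case (insert j S)
  let ?term = "\<lambda>S k. \<Prod>i\<in>S. x i ^ k i / fact (k i)"
  have upd: "(\<Prod>i\<in>S. x i ^ (if i = j then a else k i) / fact (if i = j then a else k i)) = ?term S k"
    "(\<Sum>i\<in>S. if i = j then a else k i) = sum k S" for k a
    using insert.hyps by (auto intro!: prod.cong sum.cong)
  have "sum x (insert j S) ^ p = (\<Sum>a\<le>p. of_nat (p choose a) * x j ^ a * sum x S ^ (p - a))"
    using insert.hyps by (simp add: binomial_ring)
  also have "\<dots> = (\<Sum>a\<le>p. fact p * (x j ^ a / fact a) * (\<Sum>k\<in>multi_indices S (p - a). ?term S k))"
    by (intro sum.cong refl) (simp add: insert.IH binomial_fact)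
  also have "\<dots> = fact p * (\<Sum>a\<le>p. \<Sum>k\<in>multi_indices S (p - a). x j ^ a / fact a * ?term S k)"
    by (simp add: sum_distrib_left mult.assoc)
  also have "(\<Sum>a\<le>p. \<Sum>k\<in>multi_indices S (p - a). x j ^ a / fact a * ?term S k)
      = (\<Sum>(a, k)\<in>(SIGMA a:{..p}. multi_indices S (p - a)). x j ^ a / fact a * ?term S k)"
    using insert.hyps by (intro sum.Sigma) (auto intro: finite_multi_indices)
  \<comment> \<open>A multi-index on \<open>insert j S\<close> corresponds to its value at
    \<open>j\<close> together with its restriction to \<open>S\<close>; resetting \<open>j\<close>
    to \<open>undefined\<close> makes the restriction extensional again.\<close>
  also have "\<dots> = (\<Sum>k\<in>multi_indices (insert j S) p. ?term (insert j S) k)"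
    using insert.hyps
    by (intro sum.reindex_bij_witness[where i = "\<lambda>k. (k j, k(j := undefined))"
          and j = "\<lambda>(a, k). k(j := a)"])
       (auto simp: multi_indices_def upd fun_upd_idem PiE_def extensional_def)
  finally show ?case .
qed

section \<open>Comparison of coefficients in several variables\<close>

text \<open>Terms with equal exponents may be spread over several indices, hence the sums.\<close>

lemma polynomial_coeff_eq_on:
  fixes p :: "'x \<Rightarrow> real" and q :: "'y \<Rightarrow> real"
  assumes "finite S" "finite I" "finite J"
    and "\<And>t. (\<Sum>x\<in>I. p x * (\<Prod>i\<in>S. t i ^ e x i)) = (\<Sum>y\<in>J. q y * (\<Prod>i\<in>S. t i ^ f y i))"
  shows "(\<Sum>x | x \<in> I \<and> (\<forall>i\<in>S. e x i = l i). p x) = (\<Sum>y | y \<in> J \<and> (\<forall>i\<in>S. f y i = l i). q y)"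
  using assms
proof (induction S arbitrary: I J rule: finite_induct)
  case empty
  then show ?case by simp
next
  case (insert j S)
  let ?I = "\<lambda>a. {x \<in> I. e x j = a}" and ?J = "\<lambda>a. {y \<in> J. f y j = a}"
  have "(\<Sum>x\<in>?I (l j). p x * (\<Prod>i\<in>S. t i ^ e x i)) =
        (\<Sum>y\<in>?J (l j). q y * (\<Prod>i\<in>S. t i ^ f y i))" for t
  proof -
    \<comment> \<open>\<open>N\<close> bounds all exponents of the variable \<open>j\<close>.
      Including \<open>l j\<close> ensures that this coefficient is compared even if no term has
      that exponent.\<close>
    define N where "N = Max (insert (l j) ((\<lambda>x. e x j) ` I \<union> (\<lambda>y. f y j) ` J))"
    have N: "l j \<le> N" "(\<lambda>x. e x j) ` I \<subseteq> {..N}" "(\<lambda>y. f y j) ` J \<subseteq> {..N}"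
      using insert.prems(1,2) by (auto simp: N_def)
    have upd: "(\<Prod>i\<in>S. (t(j := s)) i ^ k i) = (\<Prod>i\<in>S. t i ^ k i)" for s k
      using insert.hyps by (intro prod.cong) auto
    \<comment> \<open>With the variables in \<open>S\<close> held fixed, grouping by the exponent of
      \<open>j\<close> turns both sides into univariate polynomials in the value \<open>s\<close> at
      \<open>j\<close>. Their coefficients are polynomials in the remaining variables, to which the
      induction hypothesis applies.\<close>
    have "(\<Sum>a\<le>N. (\<Sum>x\<in>?I a. p x * (\<Prod>i\<in>S. t i ^ e x i)) * s ^ a) =
          (\<Sum>a\<le>N. (\<Sum>y\<in>?J a. q y * (\<Prod>i\<in>S. t i ^ f y i)) * s ^ a)" for s
    proof -
      have "(\<Sum>a\<le>N. (\<Sum>x\<in>?I a. p x * (\<Prod>i\<in>S. t i ^ e x i)) * s ^ a) =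
            (\<Sum>a\<le>N. \<Sum>x\<in>?I a. p x * (\<Prod>i\<in>insert j S. (t(j := s)) i ^ e x i))"
        unfolding prod.insert[OF insert.hyps] upd sum_distrib_right
        by (intro sum.cong refl) (auto simp: mult_ac)
      also have "\<dots> = (\<Sum>x\<in>I. p x * (\<Prod>i\<in>insert j S. (t(j := s)) i ^ e x i))"
        using N insert.prems by (intro sum.group) auto
      also have "\<dots> = (\<Sum>y\<in>J. q y * (\<Prod>i\<in>insert j S. (t(j := s)) i ^ f y i))"
        by (rule insert.prems(3))
      also have "\<dots> = (\<Sum>a\<le>N. \<Sum>y\<in>?J a. q y * (\<Prod>i\<in>insert j S. (t(j := s)) i ^ f y i))"
        using N insert.prems by (intro sum.group[symmetric]) auto
      also have "\<dots> = (\<Sum>a\<le>N. (\<Sum>y\<in>?J a. q y * (\<Prod>i\<in>S. t i ^ f y i)) * s ^ a)"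
        unfolding prod.insert[OF insert.hyps] upd sum_distrib_right
        by (intro sum.cong refl) (auto simp: mult_ac)
      finally show ?thesis .
    qed
    then show ?thesis
      by (rule polyfun_eq_coeffs[THEN iffD1, OF allI, rule_format, OF _ N(1)])
  qed
  from insert.IH[OF _ _ this] insert.prems(1,2) show ?case
    by (simp add: conj_assoc)
qed

lemma polynomial_coeff_eq:
  fixes p :: "'x \<Rightarrow> real" and q :: "'y \<Rightarrow> real" and l :: "'i::finite \<Rightarrow> nat"
  assumes "finite I" "finite J"
    and "\<And>t. (\<Sum>x\<in>I. p x * (\<Prod>i\<in>UNIV. t i ^ e x i)) = (\<Sum>y\<in>J. q y * (\<Prod>i\<in>UNIV. t i ^ f y i))"
  shows "(\<Sum>x | x \<in> I \<and> e x = l. p x) = (\<Sum>y | y \<in> J \<and> f y = l. q y)"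
  using polynomial_coeff_eq_on[OF finite assms, of l] by (simp add: fun_eq_iff)

section \<open>Moments of normal laws and integrability of products\<close>

lemma normal_law_moments:
  assumes "0 \<le> \<sigma>"
  shows "integrable (normal_law \<mu> \<sigma>) (\<lambda>x. (x - \<mu>) ^ k)"
    and "(\<integral>x. (x - \<mu>) ^ (2 * m) \<partial>normal_law \<mu> \<sigma>) = fact (2 * m) / (2 ^ m * fact m) * (\<sigma>\<^sup>2) ^ m"
    and "(\<integral>x. x \<partial>normal_law \<mu> \<sigma>) = \<mu>"
proof -
  consider (z) "\<sigma> = 0" | (p) "\<sigma> > 0" using assms by linarith
  note cases = this
  interpret R: prob_space "return borel \<mu>" by (rule prob_space_return) simp
  show "integrable (normal_law \<mu> \<sigma>) (\<lambda>x. (x - \<mu>) ^ k)"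
  proof (cases rule: cases)
    case z
    have "integrable (return borel \<mu>) (\<lambda>x. (x - \<mu>) ^ k) \<longleftrightarrow>
       integrable (return borel \<mu>) (\<lambda>_. (\<mu> - \<mu>) ^ k)"
      by (rule integrable_cong_AE) (auto simp: AE_return)
    with z show ?thesis by (simp add: normal_law_def)
  next
    case p
    then show ?thesis
      by (simp add: normal_law_def integrable_density normal_density_nonneg integrable_normal_moment)
  qed
  show "(\<integral>x. (x - \<mu>) ^ (2 * m) \<partial>normal_law \<mu> \<sigma>) = fact (2 * m) / (2 ^ m * fact m) * (\<sigma>\<^sup>2) ^ m"
  proof (cases rule: cases)
    case z
    \<comment> \<open>For \<open>m = 0\<close> both sides are 1, the total mass and the power
      \<open>0 ^ 0\<close>; for larger \<open>m\<close> both vanish.\<close>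
    then show ?thesis
      using R.prob_space
      by (cases "m = 0") (auto simp: normal_law_def integral_return power_0_left)
  next
    case p
    then show ?thesis
      by (simp add: normal_law_def integral_density normal_density_nonneg
          integral_normal_moment_even power_divide)
  qed
  show "(\<integral>x. x \<partial>normal_law \<mu> \<sigma>) = \<mu>"
  proof (cases rule: cases)
    case z
    then show ?thesis by (simp add: normal_law_def integral_return)
  next
    case p
    then show ?thesis
      by (simp add: normal_law_def integral_density normal_density_nonneg integral_normal_moment_nz_1)
  qed
qed

text \<open>Having moments of every order is stable under products: \<bar>x y\<bar> \<le> x^2 + y^2,
  applied to \<open>k\<close>-th powers, bounds the \<open>k\<close>-th moment of a product by
  moments of order \<open>k * 2\<close> of the factors. The induction therefore needs all exponents
  at once.\<close>

lemma integrable_prod_power: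
  fixes f :: "'i \<Rightarrow> 'a \<Rightarrow> real"
  assumes "finite_measure M" "finite S"
    and "\<And>i k. i \<in> S \<Longrightarrow> integrable M (\<lambda>\<omega>. f i \<omega> ^ k)"
  shows "integrable M (\<lambda>\<omega>. (\<Prod>i\<in>S. f i \<omega>) ^ k)"
  using assms(2,3)
proof (induction S arbitrary: k rule: finite_induct)
  case empty
  interpret finite_measure M by fact
  show ?case by simp
next
  case (insert j S)
  have f: "integrable M (\<lambda>\<omega>. f j \<omega> ^ k)" for k
    using insert.prems by blast
  have g: "integrable M (\<lambda>\<omega>. (\<Prod>i\<in>S. f i \<omega>) ^ k)" for k
    using insert by blast
  have [measurable]: "f j \<in> borel_measurable M" "(\<lambda>\<omega>. \<Prod>i\<in>S. f i \<omega>) \<in> borel_measurable M"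
    using borel_measurable_integrable[OF f[of 1]] borel_measurable_integrable[OF g[of 1]] by simp_all
  have "\<bar>x * y\<bar> \<le> x\<^sup>2 + y\<^sup>2" for x y :: real
  proof -
    have "\<bar>x * y\<bar> \<le> 2 * \<bar>x\<bar> * \<bar>y\<bar>"
      by (simp add: abs_mult)
    also have "\<dots> \<le> x\<^sup>2 + y\<^sup>2"
      using sum_squares_bound[of "\<bar>x\<bar>" "\<bar>y\<bar>"] by simp
    finally show ?thesis .
  qed
  then have dom: "\<bar>f j \<omega> ^ k * (\<Prod>i\<in>S. f i \<omega>) ^ k\<bar> \<le> f j \<omega> ^ (k * 2) + (\<Prod>i\<in>S. f i \<omega>) ^ (k * 2)" for \<omega>
    unfolding power_mult .
  have bound: "norm (f j \<omega> ^ k * (\<Prod>i\<in>S. f i \<omega>) ^ k)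
      \<le> norm (f j \<omega> ^ (k * 2) + (\<Prod>i\<in>S. f i \<omega>) ^ (k * 2))" for \<omega>
    unfolding real_norm_def by (rule order_trans[OF dom abs_ge_self])
  have "integrable M (\<lambda>\<omega>. f j \<omega> ^ (k * 2) + (\<Prod>i\<in>S. f i \<omega>) ^ (k * 2))"
    using f g by (rule Bochner_Integration.integrable_add)
  then have "integrable M (\<lambda>\<omega>. f j \<omega> ^ k * (\<Prod>i\<in>S. f i \<omega>) ^ k)"
    by (rule Bochner_Integration.integrable_bound) (measurable, intro AE_I2 bound)
  then show ?case
    using insert.hyps by (simp add: power_mult_distrib)
qed

section \<open>Moments of a centered Gaussian vector\<close>

context
  fixes M :: "'a measure" and X :: "'a \<Rightarrow> real ^ 'd"
  assumes gauss: "centered_gaussian_vector M X"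
begin

interpretation prob_space M
  using gauss by (simp add: centered_gaussian_vector_def gaussian_vector_def)

lemma gaussian_measurable: "X \<in> borel_measurable M"
  using gauss by (simp add: centered_gaussian_vector_def gaussian_vector_def)

text \<open>The law of \<open>t \<bullet> X\<close> is normal with mean 0. Its variance is written
  as an integral, which is visibly a quadratic form in \<open>t\<close>, whereas the parameter
  \<sigma> is only known to exist for each \<open>t\<close>.\<close>

lemma gaussian_integrable_power: "integrable M (\<lambda>\<omega>. (t \<bullet> X \<omega>) ^ k)"
  and gaussian_moment: "(\<integral>\<omega>. (t \<bullet> X \<omega>) ^ (2 * m) \<partial>M) =
    fact (2 * m) / (2 ^ m * fact m) * (\<integral>\<omega>. (t \<bullet> X \<omega>)\<^sup>2 \<partial>M) ^ m"
proof -
  note [measurable] = gaussian_measurable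
  \<comment> \<open>Integrability has to precede the computation of the mean: linearity of the
    integral requires it, and a vanishing Bochner integral does not imply it. Since \<mu> is still
    unknown here, it is added back after centering.\<close>
  have int: "integrable M (\<lambda>\<omega>. a \<bullet> X \<omega>)" for a
  proof -
    obtain \<mu> \<sigma> where "0 \<le> \<sigma>" and law: "distr M borel (\<lambda>\<omega>. a \<bullet> X \<omega>) = normal_law \<mu> \<sigma>"
      using gauss unfolding centered_gaussian_vector_def gaussian_vector_def by blast
    then have "integrable (distr M borel (\<lambda>\<omega>. a \<bullet> X \<omega>)) (\<lambda>x. (x - \<mu>) ^ 1)"
      by (simp only: normal_law_moments law)
    then have "integrable M (\<lambda>\<omega>. (a \<bullet> X \<omega> - \<mu>) + \<mu>)"
      by (intro Bochner_Integration.integrable_add) (simp_all add: integrable_distr_eq)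
    then show ?thesis by simp
  qed
  obtain \<mu> \<sigma> where "0 \<le> \<sigma>" and law: "distr M borel (\<lambda>\<omega>. t \<bullet> X \<omega>) = normal_law \<mu> \<sigma>"
    using gauss unfolding centered_gaussian_vector_def gaussian_vector_def by blast
  have "(\<integral>\<omega>. X \<omega> $ i \<partial>M) = 0" for i
    using gauss by (simp add: centered_gaussian_vector_def mean_vector_def vec_eq_iff)
  moreover have "integrable M (\<lambda>\<omega>. X \<omega> $ i)" for i
    using int[of "axis i 1"] by (simp add: inner_axis')
  ultimately have "(\<integral>\<omega>. t \<bullet> X \<omega> \<partial>M) = 0"
    by (simp add: inner_vec_def)
  moreover have "(\<integral>\<omega>. t \<bullet> X \<omega> \<partial>M) = (\<integral>x. x \<partial>distr M borel (\<lambda>\<omega>. t \<bullet> X \<omega>))"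
    by (simp add: integral_distr)
  ultimately have "\<mu> = 0"
    using normal_law_moments(3)[OF \<open>0 \<le> \<sigma>\<close>] by (simp add: law)
  note mom = normal_law_moments(1,2)[OF \<open>0 \<le> \<sigma>\<close>, of \<mu>, folded law, unfolded \<open>\<mu> = 0\<close>]
  show "integrable M (\<lambda>\<omega>. (t \<bullet> X \<omega>) ^ k)"
    using mom(1)[of k] by (simp add: integrable_distr_eq)
  have "(\<integral>\<omega>. (t \<bullet> X \<omega>) ^ (2 * m) \<partial>M) = fact (2 * m) / (2 ^ m * fact m) * (\<sigma>\<^sup>2) ^ m" for m
    using mom(2)[of m] by (simp add: integral_distr)
  \<comment> \<open>The case \<open>m = 1\<close> has constant 1 and identifies
    \<open>\<sigma>\<^sup>2\<close> with the second moment.\<close>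
  from this this[of 1] show "(\<integral>\<omega>. (t \<bullet> X \<omega>) ^ (2 * m) \<partial>M) =
      fact (2 * m) / (2 ^ m * fact m) * (\<integral>\<omega>. (t \<bullet> X \<omega>)\<^sup>2 \<partial>M) ^ m"
    by simp
qed

lemma gaussian_component_integrable_power: "integrable M (\<lambda>\<omega>. (X \<omega> $ i) ^ k)"
  using gaussian_integrable_power[of "axis i 1"] by (simp add: inner_axis')

lemma gaussian_component_moment:
  "(\<integral>\<omega>. (X \<omega> $ i) ^ (2 * m) \<partial>M) =
    fact (2 * m) / (2 ^ m * fact m) * (\<integral>\<omega>. X \<omega> $ i * X \<omega> $ i \<partial>M) ^ m"
  using gaussian_moment[of "axis i 1"] by (simp add: inner_axis' power2_eq_square)

lemma gaussian_integrable_prod: "integrable M (\<lambda>\<omega>. \<Prod>i\<in>S. (X \<omega> $ i) ^ k i)"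
proof (cases "finite S")
  case True
  then show ?thesis
    using integrable_prod_power[OF finite_measure_axioms True, of "\<lambda>i \<omega>. (X \<omega> $ i) ^ k i" 1]
    by (simp add: gaussian_component_integrable_power flip: power_mult)
qed simp

lemma gaussian_integrable_mult: "integrable M (\<lambda>\<omega>. X \<omega> $ i * X \<omega> $ j)"
  \<comment> \<open>Indexing the two factors by \<open>bool\<close> keeps them distinct when
    \<open>i = j\<close>.\<close>
  using integrable_prod_power[OF finite_measure_axioms, of "UNIV :: bool set" "\<lambda>b \<omega>. X \<omega> $ (if b then i else j)" 1]
  by (simp add: gaussian_component_integrable_power UNIV_bool mult.commute)

text \<open>A form of Isserlis' formula: the normalized mixed moment is the sum of
  \<open>q r / 2 ^ m\<close> over the matrices \<open>r\<close> of total \<open>m\<close> with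
  \<open>e r = (\<lambda>i. 2 * n i)\<close>. Nonnegative second moments make every summand
  nonnegative, so one of them bounds the sum from below.\<close>

lemma gaussian_moment_ge:
  assumes "\<And>i j. 0 \<le> (\<integral>\<omega>. X \<omega> $ i * X \<omega> $ j \<partial>M)"
  shows "(\<Prod>i\<in>UNIV. \<integral>\<omega>. (X \<omega> $ i) ^ (2 * n i) \<partial>M) \<le> (\<integral>\<omega>. (\<Prod>i\<in>UNIV. (X \<omega> $ i) ^ (2 * n i)) \<partial>M)"
proof -
  define \<sigma> where "\<sigma> i j = (\<integral>\<omega>. X \<omega> $ i * X \<omega> $ j \<partial>M)" for i j
  define m where "m = sum n UNIV"
  \<comment> \<open>\<open>p k\<close> is the coefficient of the monomial with exponents
    \<open>k\<close> in the moment of order \<open>2 * m\<close> of \<open>t \<bullet> X\<close>,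
    divided by \<open>fact (2 * m)\<close>.\<close>
  define p where "p k = (\<integral>\<omega>. (\<Prod>i\<in>UNIV. (X \<omega> $ i) ^ k i) \<partial>M) / (\<Prod>i\<in>UNIV. fact (k i))" for k
  \<comment> \<open>Here \<open>r\<close> counts how often each ordered pair is chosen when the
    double sum for the variance is raised to the power \<open>m\<close>. A pair
    \<open>(i, j)\<close> contributes one factor \<open>t $ i\<close> and one factor
    \<open>t $ j\<close>, so \<open>e r\<close> adds row and column sums.\<close>
  define q where "q r = (\<Prod>(i, j)\<in>UNIV. \<sigma> i j ^ r (i, j) / fact (r (i, j)))" for r
  define e where "e r i = (\<Sum>j\<in>UNIV. r (i, j)) + (\<Sum>j\<in>UNIV. r (j, i))" for r :: "'d \<times> 'd \<Rightarrow> nat" and i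
  \<comment> \<open>The multi-index with \<open>q r\<^sub>0 = (\<Prod>i\<in>UNIV. \<sigma> i i ^ n i / fact (n i))\<close>, the term that independent
    components would contribute.\<close>
  define r\<^sub>0 where "r\<^sub>0 = (\<lambda>(i, j). if i = j then n i else 0)"
  have lhs: "(\<integral>\<omega>. (t \<bullet> X \<omega>) ^ (2 * m) \<partial>M) =
      fact (2 * m) * (\<Sum>k\<in>multi_indices UNIV (2 * m). p k * (\<Prod>i\<in>UNIV. t $ i ^ k i))" for t
  proof -
    have "(t \<bullet> X \<omega>) ^ (2 * m) = fact (2 * m) * (\<Sum>k\<in>multi_indices UNIV (2 * m).
        (\<Prod>i\<in>UNIV. (X \<omega> $ i) ^ k i) * ((\<Prod>i\<in>UNIV. t $ i ^ k i) / (\<Prod>i\<in>UNIV. fact (k i))))" for \<omega>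
      by (simp add: inner_vec_def multinomial_theorem power_mult_distrib prod_dividef prod.distrib mult_ac)
    then show ?thesis
      by (simp add: gaussian_integrable_prod p_def)
  qed
  have variance: "(\<integral>\<omega>. (t \<bullet> X \<omega>)\<^sup>2 \<partial>M) = (\<Sum>x\<in>UNIV. case x of (i, j) \<Rightarrow> \<sigma> i j * (t $ i * t $ j))" for t
  proof -
    have "(t \<bullet> X \<omega>)\<^sup>2 = (\<Sum>i\<in>UNIV. \<Sum>j\<in>UNIV. X \<omega> $ i * X \<omega> $ j * (t $ i * t $ j))" for \<omega>
      by (simp add: inner_vec_def power2_eq_square sum_product mult_ac)
    then have "(\<integral>\<omega>. (t \<bullet> X \<omega>)\<^sup>2 \<partial>M) = (\<Sum>i\<in>UNIV. \<Sum>j\<in>UNIV. \<sigma> i j * (t $ i * t $ j))"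
      by (simp add: gaussian_integrable_mult \<sigma>_def)
    then show ?thesis
      by (simp add: sum.cartesian_product)
  qed
  have exponent: "(\<Prod>(i, j)\<in>UNIV. (t $ i * t $ j) ^ r (i, j)) = (\<Prod>i\<in>UNIV. t $ i ^ e r i)"
    for t :: "real ^ 'd" and r
  proof -
    have "(\<Prod>(i, j)\<in>UNIV. (t $ i * t $ j) ^ r (i, j)) =
        (\<Prod>i\<in>UNIV. \<Prod>j\<in>UNIV. t $ i ^ r (i, j)) * (\<Prod>i\<in>UNIV. \<Prod>j\<in>UNIV. t $ j ^ r (i, j))"
      by (simp add: power_mult_distrib prod.distrib prod.cartesian_product case_prod_unfold)
    \<comment> \<open>Exchanging the products brings the index of \<open>t\<close> to the outside;
      the inner exponents then add up to the column sum in \<open>e\<close>.\<close>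
    also have "(\<Prod>i\<in>UNIV. \<Prod>j\<in>UNIV. t $ j ^ r (i, j)) = (\<Prod>i\<in>UNIV. \<Prod>j\<in>UNIV. t $ i ^ r (j, i))"
      by (rule prod.swap)
    finally show ?thesis
      by (simp add: e_def power_add power_sum prod.distrib)
  qed
  have rhs: "(\<integral>\<omega>. (t \<bullet> X \<omega>)\<^sup>2 \<partial>M) ^ m =
      fact m * (\<Sum>r\<in>multi_indices UNIV m. q r * (\<Prod>i\<in>UNIV. t $ i ^ e r i))" for t
    unfolding variance multinomial_theorem[OF finite]
    by (simp add: case_prod_unfold power_mult_distrib q_def prod.distrib prod_dividef
        flip: exponent)
  \<comment> \<open>The \<open>fact m\<close> from the expansion of the variance cancels the one in
    the moment formula, and \<open>fact (2 * m)\<close> cancels from both sides, leaving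
    \<open>2 ^ m\<close>.\<close>
  have "(\<Sum>k\<in>multi_indices UNIV (2 * m). p k * (\<Prod>i\<in>UNIV. t i ^ k i)) =
      (\<Sum>r\<in>multi_indices UNIV m. q r / 2 ^ m * (\<Prod>i\<in>UNIV. t i ^ e r i))" for t
  proof -
    have "fact (2 * m) * (\<Sum>k\<in>multi_indices UNIV (2 * m). p k * (\<Prod>i\<in>UNIV. t i ^ k i)) =
        fact (2 * m) * ((\<Sum>r\<in>multi_indices UNIV m. q r * (\<Prod>i\<in>UNIV. t i ^ e r i)) / 2 ^ m)"
      using gaussian_moment[of "\<chi> i. t i" m] unfolding lhs rhs by simp
    then show ?thesis
      unfolding mult_cancel_left by (simp add: sum_divide_distrib)
  qed
  from polynomial_coeff_eq[OF _ _ this, of "\<lambda>i. 2 * n i"]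
  have "(\<Sum>k | k \<in> multi_indices UNIV (2 * m) \<and> k = (\<lambda>i. 2 * n i). p k) =
      (\<Sum>r | r \<in> multi_indices UNIV m \<and> e r = (\<lambda>i. 2 * n i). q r / 2 ^ m)"
    by (simp add: finite_multi_indices)
  \<comment> \<open>The target exponents sum to \<open>2 * m\<close>, so the left side reduces to a
    single mixed moment.\<close>
  moreover have "{k. k \<in> multi_indices UNIV (2 * m) \<and> k = (\<lambda>i. 2 * n i)} = {\<lambda>i. 2 * n i}"
    by (auto simp: multi_indices_def m_def sum_distrib_left)
  ultimately have "p (\<lambda>i. 2 * n i) =
      (\<Sum>r | r \<in> multi_indices UNIV m \<and> e r = (\<lambda>i. 2 * n i). q r / 2 ^ m)"
    by simp
  moreover have "q r\<^sub>0 / 2 ^ m \<le> (\<Sum>r | r \<in> multi_indices UNIV m \<and> e r = (\<lambda>i. 2 * n i). q r / 2 ^ m)"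
  proof (rule member_le_sum)
    have "sum r\<^sub>0 UNIV = (\<Sum>i\<in>UNIV. \<Sum>j\<in>UNIV. r\<^sub>0 (i, j))"
      by (simp add: sum.cartesian_product)
    also have "\<dots> = m"
      by (simp add: r\<^sub>0_def m_def)
    finally have "sum r\<^sub>0 UNIV = m" .
    \<comment> \<open>Each diagonal entry occurs once in a row sum and once in a column sum, whence
      the factor 2.\<close>
    moreover have "e r\<^sub>0 = (\<lambda>i. 2 * n i)"
      by (simp add: e_def r\<^sub>0_def fun_eq_iff)
    ultimately show "r\<^sub>0 \<in> {r. r \<in> multi_indices UNIV m \<and> e r = (\<lambda>i. 2 * n i)}"
      by (simp add: multi_indices_def)
    show "0 \<le> q r / 2 ^ m" for r
      unfolding q_def \<sigma>_def using assms by (intro divide_nonneg_nonneg prod_nonneg) auto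
    show "finite {r. r \<in> multi_indices UNIV m \<and> e r = (\<lambda>i. 2 * n i)}"
      by (simp add: finite_multi_indices)
  qed
  moreover have "q r\<^sub>0 = (\<Prod>i\<in>UNIV. \<sigma> i i ^ n i / fact (n i))"
  proof -
    have "q r\<^sub>0 = (\<Prod>i\<in>UNIV. \<Prod>j\<in>UNIV. \<sigma> i j ^ r\<^sub>0 (i, j) / fact (r\<^sub>0 (i, j)))"
      by (simp add: q_def prod.cartesian_product)
    also have "\<dots> = (\<Prod>i\<in>UNIV. \<Prod>j\<in>UNIV. if i = j then \<sigma> i i ^ n i / fact (n i) else 1)"
      by (intro prod.cong) (auto simp: r\<^sub>0_def)
    finally show ?thesis by simp
  qed
  \<comment> \<open>Since \<open>m\<close> is the sum of the \<open>n i\<close>, the power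
    \<open>2 ^ m\<close> distributes over the components and completes each one-dimensional moment
    formula.\<close>
  moreover have "(\<Prod>i\<in>UNIV. \<sigma> i i ^ n i / fact (n i)) / 2 ^ m =
      (\<Prod>i\<in>UNIV. \<integral>\<omega>. (X \<omega> $ i) ^ (2 * n i) \<partial>M) / (\<Prod>i\<in>UNIV. fact (2 * n i))"
    unfolding gaussian_component_moment \<sigma>_def m_def power_sum
    by (simp add: prod_dividef prod.distrib)
  ultimately have "(\<Prod>i\<in>UNIV. \<integral>\<omega>. (X \<omega> $ i) ^ (2 * n i) \<partial>M) / (\<Prod>i\<in>UNIV. fact (2 * n i))
      \<le> (\<integral>\<omega>. (\<Prod>i\<in>UNIV. (X \<omega> $ i) ^ (2 * n i)) \<partial>M) / (\<Prod>i\<in>UNIV. fact (2 * n i))"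
    unfolding p_def by (simp only:)
  moreover have "(0 :: real) < (\<Prod>i\<in>UNIV. fact (2 * n i))"
    by (intro prod_pos) simp
  ultimately show ?thesis
    by (simp only: divide_le_cancel)
qed

end

section \<open>Sign change and reduction to nonnegative second moments\<close>

theorem proposition2:
  fixes M :: "'a measure" and X :: "'a \<Rightarrow> real ^ 'd"
    and N :: "'b measure" and Z :: "'b \<Rightarrow> real ^ 'd"
    and n :: "'d \<Rightarrow> nat"
  assumes "centered_gaussian_vector M X"
    and "standard_gaussian_vector N Z"
    and "\<exists>D C :: real ^ 'd ^ 'd.
           signature_matrix D \<and> (\<forall>i j. 0 \<le> C $ i $ j) \<and>
           distr M borel (\<lambda>\<omega>. D *v X \<omega>) = distr N borel (\<lambda>\<omega>. C *v Z \<omega>)"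
  shows "(\<integral>\<omega>. (\<Prod>i\<in>UNIV. (X \<omega> $ i) ^ (2 * n i)) \<partial>M)
           \<ge> (\<Prod>i\<in>UNIV. \<integral>\<omega>. (X \<omega> $ i) ^ (2 * n i) \<partial>M)"
proof -
  obtain D C :: "real ^ 'd ^ 'd" where D: "signature_matrix D" and C: "\<And>i j. 0 \<le> C $ i $ j"
    and law: "distr M borel (\<lambda>\<omega>. D *v X \<omega>) = distr N borel (\<lambda>\<omega>. C *v Z \<omega>)"
    using assms(3) by blast
  have Z_cov: "(\<integral>\<omega>. Z \<omega> $ i * Z \<omega> $ j \<partial>N) = (mat 1 :: real ^ 'd ^ 'd) $ i $ j" for i j
  proof -
    have "covariance_matrix N Z $ i $ j = (mat 1 :: real ^ 'd ^ 'd) $ i $ j" and "mean_vector N Z = 0"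
      using assms(2) by (simp_all add: standard_gaussian_vector_def)
    then show ?thesis
      by (simp add: covariance_matrix_def)
  qed
  \<comment> \<open>\<open>Y\<close> has the same even powers as \<open>X\<close> in every
    component, so the inequality may be proved for \<open>Y\<close>, whose mixed second moments are
    nonnegative.\<close>
  define Y where "Y \<omega> = D *v X \<omega>" for \<omega>
  have Z: "centered_gaussian_vector N Z"
    using assms(2) by (simp add: standard_gaussian_vector_def centered_gaussian_vector_def)
  note [measurable] = gaussian_measurable[OF assms(1)] gaussian_measurable[OF Z]
  have [measurable]: "(\<lambda>x. A *v x) \<in> borel_measurable borel" for A :: "real ^ 'd ^ 'd"
    by (intro borel_measurable_continuous_onI) (simp add: linear_continuous_on)
  have Y_nth: "Y \<omega> $ i = D $ i $ i * X \<omega> $ i" for \<omega> i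
  proof -
    have "Y \<omega> $ i = (\<Sum>j\<in>UNIV. if j = i then D $ i $ i * X \<omega> $ i else 0)"
      using D unfolding Y_def signature_matrix_def matrix_vector_mult_def vec_lambda_beta
      by (intro sum.cong) auto
    then show ?thesis by simp
  qed
  have "(D $ i $ i)\<^sup>2 = 1" for i
    using D by (simp add: signature_matrix_def power2_eq_1_iff)
  then have Y_power: "(Y \<omega> $ i) ^ (2 * k) = (X \<omega> $ i) ^ (2 * k)" for \<omega> i k
    by (simp add: Y_nth power_mult_distrib power_mult)
  have "centered_gaussian_vector M Y"
    unfolding centered_gaussian_vector_def gaussian_vector_def
  proof (intro conjI allI)
    show "prob_space M"
      using assms(1) by (simp add: centered_gaussian_vector_def gaussian_vector_def)
    show "Y \<in> borel_measurable M"
      unfolding Y_def[abs_def] by measurable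
    \<comment> \<open>Linear forms in \<open>Y\<close> are linear forms in \<open>X\<close>, so
      their laws are normal.\<close>
    have "a \<bullet> Y \<omega> = (transpose D *v a) \<bullet> X \<omega>" for a \<omega>
      by (simp add: Y_def dot_lmul_matrix)
    then show "\<exists>\<mu> \<sigma>. 0 \<le> \<sigma> \<and> distr M borel (\<lambda>\<omega>. a \<bullet> Y \<omega>) = normal_law \<mu> \<sigma>" for a
      using assms(1) by (simp add: centered_gaussian_vector_def gaussian_vector_def)
    show "mean_vector M Y = 0"
      using assms(1) by (simp add: centered_gaussian_vector_def mean_vector_def vec_eq_iff Y_nth)
  qed
  moreover have "0 \<le> (\<integral>\<omega>. Y \<omega> $ i * Y \<omega> $ j \<partial>M)" for i j
  proof -
    \<comment> \<open>Second moments depend only on the law, which is shared with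
      \<open>C *v Z\<close>. As the second moments of \<open>Z\<close> are 0 or 1, the resulting
      combination with products of entries of \<open>C\<close> is nonnegative.\<close>
    have "(\<integral>\<omega>. Y \<omega> $ i * Y \<omega> $ j \<partial>M) = (\<integral>y. y $ i * y $ j \<partial>distr M borel (\<lambda>\<omega>. D *v X \<omega>))"
      by (simp add: integral_distr Y_def)
    also have "\<dots> = (\<integral>\<omega>. (C *v Z \<omega>) $ i * (C *v Z \<omega>) $ j \<partial>N)"
      unfolding law by (simp add: integral_distr)
    also have "\<dots> = (\<integral>\<omega>. (\<Sum>k\<in>UNIV. \<Sum>l\<in>UNIV. C $ i $ k * C $ j $ l * (Z \<omega> $ k * Z \<omega> $ l)) \<partial>N)"
      by (simp add: matrix_vector_mult_def sum_product mult_ac)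
    also have "\<dots> = (\<Sum>k\<in>UNIV. \<Sum>l\<in>UNIV. C $ i $ k * C $ j $ l * (\<integral>\<omega>. Z \<omega> $ k * Z \<omega> $ l \<partial>N))"
      by (simp add: gaussian_integrable_mult[OF Z])
    also have "\<dots> \<ge> 0"
      using C by (intro sum_nonneg mult_nonneg_nonneg) (auto simp: Z_cov mat_def)
    finally show ?thesis .
  qed
  ultimately have "(\<Prod>i\<in>UNIV. \<integral>\<omega>. (Y \<omega> $ i) ^ (2 * n i) \<partial>M)
      \<le> (\<integral>\<omega>. (\<Prod>i\<in>UNIV. (Y \<omega> $ i) ^ (2 * n i)) \<partial>M)"
    by (rule gaussian_moment_ge)
  then show ?thesis
    by (simp only: Y_power)
qed

end
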